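(* Let $G$ be an undirected graph with positive edge weights. Suppose that for every set $S$ of 4 nodes of $G$ there is a shortest path in $G$ containing every node of $S$. Then there exists a pair $(s,t)$ of nodes of $G$ such that some shortest $st$-path contains every node of $G$.
   Context: A shortest path is a path from some node $u$ to some node $v$ whose total weight equals the shortest-path distance $\mathrm{dist}(u,v)$; "a shortest path containing every node of $S$" means a shortest path between some pair of nodes whose node set includes $S$.
   Formalization: The graph is taken to be finite and simple with at least 4 nodes; otherwise the claim fails (the unit-weight triangle satisfies the hypothesis vacuously, and the infinite unit-weight line has no path containing every node). *)

theory Defs
  imports "Graph_Theory.Shortest_Path"
begin

context wf_digraph
begin

text \<open>The distance \<^term>\<open>\<mu> w u v\<close> is extended-real-valued: it is \<open>\<infinity>\<close> when \<open>v\<close> is not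
  reachable from \<open>u\<close>.\<close>

definition shortest_path :: "'b weight_fun \<Rightarrow> 'a \<Rightarrow> 'b awalk \<Rightarrow> 'a \<Rightarrow> bool" where
  "shortest_path w u p v \<longleftrightarrow> apath u p v \<and> ereal (awalk_cost w p) = \<mu> w u v"

end

text \<open>An undirected edge is a pair of opposite arcs of a symmetric digraph, so a weighting of the
  undirected edges is a weighting of the arcs that agrees on opposite arcs.\<close>

definition symmetric_weights :: "('a, 'b) pre_digraph \<Rightarrow> 'b weight_fun \<Rightarrow> bool" where
  "symmetric_weights G w \<longleftrightarrow>
    (\<forall>e \<in> arcs G. \<forall>e' \<in> arcs G. tail G e = head G e' \<and> head G e = tail G e' \<longrightarrow> w e = w e')"

end

theory Submission
  imports Defs
begin

text \<open>
  Shortest-path distances along a shortest path are those of points on the real line. Let \<open>s\<close>, \<open>t\<close> be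
  nodes at maximum distance and \<open>f x = dist(s, x)\<close>. For any nodes \<open>x\<close>, \<open>y\<close> the four nodes
  \<open>s, t, x, y\<close> are isometric to points on the line with \<open>s\<close> and \<open>t\<close> as endpoints, hence
  \<open>dist(x, y) = \<bar>f x - f y\<bar>\<close>. Therefore, if all nodes are listed in increasing order of \<open>f\<close>, the
  concatenation of shortest paths between consecutive nodes is a walk whose weight telescopes to the
  distance of its endpoints; as weights are positive, such a walk is a path.
\<close>

context wf_digraph
begin

text \<open>Exchange argument: a walk from \<open>x\<close> to \<open>y\<close> cheaper than
  \<open>q\<close> could replace it between \<open>p\<close> and \<open>r\<close>, giving a walk
  from \<open>u\<close> to \<open>v\<close> below the minimum.\<close>

lemma \<mu>_subwalk:
  assumes p: "awalk u p x" and q: "awalk x q y" and r: "awalk y r v"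
    and opt: "ereal (awalk_cost w (p @ q @ r)) = \<mu> w u v"
  shows "\<mu> w x y = ereal (awalk_cost w q)"
proof (rule antisym)
  show "\<mu> w x y \<le> ereal (awalk_cost w q)"
    using q by (rule min_cost_le_walk_cost)
  show "ereal (awalk_cost w q) \<le> \<mu> w x y"
    unfolding \<mu>_def
  proof (rule INF_greatest)
    fix q' assume "q' \<in> {q'. awalk x q' y}"
    then have "awalk u (p @ q' @ r) v"
      using p r by (blast intro: awalk_appendI)
    then have "\<mu> w u v \<le> ereal (awalk_cost w (p @ q' @ r))"
      by (rule min_cost_le_walk_cost)
    then show "ereal (awalk_cost w q) \<le> ereal (awalk_cost w q')"
      by (simp flip: opt)
  qed
qed

text \<open>A repeated node would cut out a nonempty closed subwalk. Its cost is positive, so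
  deleting it would undercut the minimum.\<close>

lemma minimal_awalk_imp_shortest_path:
  assumes pos: "\<And>e. e \<in> arcs G \<Longrightarrow> 0 < w e"
    and p: "awalk u p v" and opt: "ereal (awalk_cost w p) = \<mu> w u v"
  shows "shortest_path w u p v"
proof -
  have "distinct (awalk_verts u p)"
  proof (rule ccontr)
    assume "\<not> distinct (awalk_verts u p)"
    then obtain q r s z where dec: "p = q @ r @ s" "0 < length r"
      and walks: "awalk u q z" "awalk z r z" "awalk z s v"
      using awalk_not_distinct_decomp[OF p] by blast
    have "\<mu> w u v \<le> ereal (awalk_cost w (q @ s))"
      using walks by (intro min_cost_le_walk_cost awalk_appendI)
    then have "awalk_cost w r \<le> 0"
      by (simp add: dec flip: opt)
    moreover obtain e r' where "r = e # r'"
      using dec(2) by (cases r) auto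
    moreover from this walks(2) have "e \<in> arcs G" "awalk (head G e) r' z"
      by (auto simp: awalk_Cons_iff)
    then have "0 < w e" "0 \<le> awalk_cost w r'"
      using pos by (auto intro: pos_cost_pos_awalk_cost less_imp_le)
    ultimately show False by simp
  qed
  with p opt show ?thesis
    by (simp add: shortest_path_def apath_def)
qed

text \<open>Induction on the list, prepending one piece at a time. Only a walk is claimed, as the
  pieces may share nodes; distinctness is recovered later from minimality of the cost.\<close>

lemma exists_awalk_through_sorted_list:
  fixes f :: "'a \<Rightarrow> real"
  assumes step: "\<And>x y. x \<in> A \<Longrightarrow> y \<in> A \<Longrightarrow> f x \<le> f y \<Longrightarrow>
      \<exists>p. awalk x p y \<and> awalk_cost w p = f y - f x"
    and "xs \<noteq> []" "set xs \<subseteq> A" "A \<subseteq> verts G" "sorted (map f xs)"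
  shows "\<exists>p. awalk (hd xs) p (last xs) \<and> awalk_cost w p = f (last xs) - f (hd xs) \<and>
      set xs \<subseteq> set (awalk_verts (hd xs) p)"
  using assms(2-)
proof (induction xs rule: induct_list012)
  case (2 x)
  then show ?case by (intro exI[of _ "[]"]) (auto simp: awalk_Nil_iff)
next
  case (3 x y xs)
  then obtain p where p: "awalk y p (last (y # xs))"
    "awalk_cost w p = f (last (y # xs)) - f y" "set (y # xs) \<subseteq> set (awalk_verts y p)"
    by auto
  obtain q where q: "awalk x q y" "awalk_cost w q = f y - f x"
    using step[of x y] 3 by auto
  have "set (x # y # xs) \<subseteq> set (awalk_verts x (q @ p))"
    using p(3) hd_in_awalk_verts(1)[OF q(1)]
    unfolding set_awalk_verts_append[OF q(1) p(1)] by auto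
  moreover have "awalk x (q @ p) (last (y # xs))"
    using q(1) p(1) by (rule awalk_appendI)
  ultimately show ?case
    using p(2) q(2) by (intro exI[of _ "q @ p"]) simp
qed simp

end

context sym_digraph
begin

text \<open>Each arc is traversed backwards along an opposite arc; any choice of it will do, since
  \<open>w\<close> agrees on all opposite arcs.\<close>

lemma reverse_awalk:
  assumes sym: "symmetric_weights G w" and "awalk u p v"
  shows "\<exists>q. awalk v q u \<and> awalk_cost w q = awalk_cost w p"
  using assms(2)
proof (induction p arbitrary: u)
  case Nil
  then show ?case by (intro exI[of _ "[]"]) (auto simp: awalk_Nil_iff)
next
  case (Cons e p)
  then have e: "e \<in> arcs G" "tail G e = u" and "awalk (head G e) p v"
    by (auto simp: awalk_Cons_iff)
  with Cons.IH obtain q where q: "awalk v q (head G e)" "awalk_cost w q = awalk_cost w p"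
    by blast
  have "(head G e, tail G e) \<in> arcs_ends G"
    using arcs_ends_symmetric[OF sym_arcs] in_arcs_imp_in_arcs_ends[OF e(1)] by blast
  then obtain e' where e': "e' \<in> arcs G" "tail G e' = head G e" "head G e' = tail G e"
    by (auto simp: arcs_ends_conv)
  then have "w e' = w e"
    using sym e(1) unfolding symmetric_weights_def by metis
  moreover have "awalk v (q @ [e']) u"
    using awalk_appendI[OF q(1)] arc_implies_awalk[OF e'(1)] e'(2,3) e(2) by simp
  ultimately show ?case
    using q(2) by (intro exI[of _ "q @ [e']"]) simp
qed

lemma \<mu>_commute:
  assumes "symmetric_weights G w"
  shows "\<mu> w u v = \<mu> w v u"
proof -
  have "\<mu> w x y \<le> \<mu> w y x" for x y
    unfolding \<mu>_def[of w y x]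
  proof (rule INF_greatest)
    fix p assume "p \<in> {p. awalk y p x}"
    then obtain q where "awalk x q y" "awalk_cost w q = awalk_cost w p"
      using reverse_awalk[OF assms] by blast
    then show "\<mu> w x y \<le> ereal (awalk_cost w p)"
      using min_cost_le_walk_cost by metis
  qed
  then show ?thesis by (simp add: antisym)
qed

lemma shortest_path_isometric_to_line:
  assumes sym: "symmetric_weights G w" and nonneg: "\<And>e. e \<in> arcs G \<Longrightarrow> 0 \<le> w e"
    and sp: "shortest_path w u p v"
  shows "\<exists>g :: 'a \<Rightarrow> real. \<forall>x \<in> set (awalk_verts u p). \<forall>y \<in> set (awalk_verts u p).
      \<mu> w x y = ereal \<bar>g x - g y\<bar>"
proof -
  \<comment> \<open>The coordinate of a node is its distance from the start \<open>u\<close>. On the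
    nodes of \<open>p\<close> this distance is finite, so passing to reals loses nothing.\<close>
  define g where "g x = real_of_ereal (\<mu> w u x)" for x
  have p: "awalk u p v" and opt: "ereal (awalk_cost w p) = \<mu> w u v"
    using sp by (auto simp: shortest_path_def apath_def)
  have ordered: "\<mu> w x y = ereal \<bar>g x - g y\<bar>"
    if "p = q @ r @ s" "awalk u q x" "awalk x r y" "awalk y s v" for q r s x y
  proof -
    \<comment> \<open>With the empty prefix, \<open>\<mu>_subwalk\<close> makes initial segments
      optimal too, so \<open>g\<close> measures position along \<open>p\<close>.\<close>
    have u: "awalk u [] u"
      using p by (auto simp: awalk_Nil_iff)
    have "\<mu> w u x = ereal (awalk_cost w q)"
      using \<mu>_subwalk[OF u that(2) awalk_appendI[OF that(3,4)]] that(1) opt by simp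
    moreover have "\<mu> w u y = ereal (awalk_cost w (q @ r))"
      using \<mu>_subwalk[OF u awalk_appendI[OF that(2,3)] that(4)] that(1) opt by simp
    moreover have "\<mu> w x y = ereal (awalk_cost w r)"
      using \<mu>_subwalk[OF that(2-4)] that(1) opt by simp
    moreover have "0 \<le> awalk_cost w r"
      using that(3) nonneg by (rule pos_cost_pos_awalk_cost)
    ultimately show ?thesis by (simp add: g_def)
  qed
  have "\<mu> w x y = ereal \<bar>g x - g y\<bar>"
    if x: "x \<in> set (awalk_verts u p)" and y: "y \<in> set (awalk_verts u p)" for x y
  proof -
    obtain q r where qr: "p = q @ r" "awalk u q x" "awalk x r v"
      using awalk_decomp[OF p x] by blast
    then consider "y \<in> set (awalk_verts u q)" | "y \<in> set (awalk_verts x r)"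
      using y set_awalk_verts_append by blast
    then show ?thesis
    proof cases
      \<comment> \<open>Here \<open>y\<close> precedes \<open>x\<close>, so \<open>ordered\<close>
        applies with the two exchanged and symmetry of the distance turns the result around.\<close>
      case 1
      then obtain q1 q2 where "q = q1 @ q2" "awalk u q1 y" "awalk y q2 x"
        using awalk_decomp[OF qr(2)] by blast
      then have "\<mu> w y x = ereal \<bar>g y - g x\<bar>"
        using qr by (intro ordered[of q1 q2 r]) auto
      then show ?thesis
        by (simp add: \<mu>_commute[OF sym, of x y] abs_minus_commute)
    next
      case 2
      then obtain r1 r2 where "r = r1 @ r2" "awalk x r1 y" "awalk y r2 v"
        using awalk_decomp[OF qr(3)] by blast
      then show ?thesis
        using qr by (intro ordered[of q r1 r2]) auto
    qed
  qed
  then show ?thesis by blast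
qed

end

theorem theorem1p2:
  fixes G :: "('a, 'b) pre_digraph" and w :: "'b \<Rightarrow> real"
  assumes "graph G"
    and "symmetric_weights G w"
    and "\<forall>e \<in> arcs G. 0 < w e"
    and "4 \<le> card (verts G)"
    and "\<forall>S \<subseteq> verts G. card S = 4 \<longrightarrow>
      (\<exists>u \<in> verts G. \<exists>v \<in> verts G. \<exists>p. wf_digraph.shortest_path G w u p v \<and>
        S \<subseteq> set (pre_digraph.awalk_verts G u p))"
  shows "\<exists>s \<in> verts G. \<exists>t \<in> verts G. \<exists>p. wf_digraph.shortest_path G w s p t \<and>
      verts G \<subseteq> set (pre_digraph.awalk_verts G s p)"
proof -
  interpret graph G by fact
  note sym = assms(2)
  have pos: "0 < w e" and nonneg: "0 \<le> w e" if "e \<in> arcs G" for e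
    using assms(3) that by (auto intro: less_imp_le)
  have line: "\<exists>g :: 'a \<Rightarrow> real. \<forall>x\<in>S. \<forall>y\<in>S. \<mu> w x y = ereal \<bar>g x - g y\<bar>"
    if S: "S \<subseteq> verts G" "card S \<le> 4" for S
  proof -
    \<comment> \<open>Smaller sets are padded to four nodes, so coincidences among the nodes
      considered below do no harm.\<close>
    obtain T where T: "S \<subseteq> T" "T \<subseteq> verts G" "card T = 4"
      using exists_subset_between[OF S(2) assms(4) S(1) finite_verts] by blast
    then obtain u v p where "shortest_path w u p v" and sub: "T \<subseteq> set (awalk_verts u p)"
      using assms(5) by blast
    from shortest_path_isometric_to_line[OF sym nonneg this(1)] sub T(1) show ?thesis
      by (meson subsetD)
  qed
  define d where "d x y = real_of_ereal (\<mu> w x y)" for x y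
  have \<mu>_d: "\<mu> w x y = ereal (d x y)" if xy: "x \<in> verts G" "y \<in> verts G" for x y
  proof -
    \<comment> \<open>Two nodes always lie on a common shortest path, so all distances are
      finite.\<close>
    have "card {x, y} \<le> 4"
      using card_length[of "[x, y]"] by simp
    then obtain g :: "'a \<Rightarrow> real" where "\<mu> w x y = ereal \<bar>g x - g y\<bar>"
      using line[of "{x, y}"] xy by blast
    then show ?thesis by (simp add: d_def)
  qed
  define D where "D = (\<lambda>(x, y). d x y) ` (verts G \<times> verts G)"
  have "finite D" "D \<noteq> {}"
    using assms(4) by (auto simp: D_def)
  then have "Max D \<in> D" by (rule Max_in)
  then obtain s t where st: "s \<in> verts G" "t \<in> verts G" "d s t = Max D"
    by (auto simp: D_def)
  have max: "d x y \<le> d s t" if "x \<in> verts G" "y \<in> verts G" for x y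
    unfolding st(3) using \<open>finite D\<close> that by (intro Max_ge) (auto simp: D_def)
  have d_eq: "d x y = \<bar>d s x - d s y\<bar>" if xy: "x \<in> verts G" "y \<in> verts G" for x y
  proof -
    have "card {s, t, x, y} \<le> 4"
      using card_length[of "[s, t, x, y]"] by simp
    then obtain g :: "'a \<Rightarrow> real" where
      "\<forall>a\<in>{s, t, x, y}. \<forall>b\<in>{s, t, x, y}. \<mu> w a b = ereal \<bar>g a - g b\<bar>"
      using line[of "{s, t, x, y}"] st xy by blast
    then have g: "d a b = \<bar>g a - g b\<bar>" if "a \<in> {s, t, x, y}" "b \<in> {s, t, x, y}" for a b
      using that by (simp only: d_def real_of_ereal.simps)
    \<comment> \<open>No distance exceeds that of \<open>s\<close> and \<open>t\<close>. The bounds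
      from both ends force \<open>g x\<close> and \<open>g y\<close> between \<open>g s\<close> and
      \<open>g t\<close>, hence on the same side of \<open>g s\<close>.\<close>
    have "\<bar>g s - g x\<bar> \<le> \<bar>g s - g t\<bar>" "\<bar>g s - g y\<bar> \<le> \<bar>g s - g t\<bar>"
      "\<bar>g t - g x\<bar> \<le> \<bar>g s - g t\<bar>" "\<bar>g t - g y\<bar> \<le> \<bar>g s - g t\<bar>"
      using max[of s x] max[of s y] max[of t x] max[of t y] st xy by (simp_all add: g)
    then have "\<bar>g x - g y\<bar> = \<bar>\<bar>g s - g x\<bar> - \<bar>g s - g y\<bar>\<bar>"
      by linarith
    then show ?thesis by (simp add: g)
  qed
  have step: "\<exists>p. awalk x p y \<and> awalk_cost w p = d s y - d s x"
    if "x \<in> verts G" "y \<in> verts G" "d s x \<le> d s y" for x y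
  proof -
    \<comment> \<open>Finite distance means reachability, and then some path attains the
      minimum.\<close>
    have "x \<rightarrow>\<^sup>*\<^bsub>G\<^esub> y"
      using \<mu>_d[OF that(1,2)] \<mu>_reach_conv[of w x y] by simp
    then obtain p where "apath x p y" "\<mu> w x y = awalk_cost w p"
      using min_cost_awalk[of x y w] nonneg by blast
    then show ?thesis
      using \<mu>_d[OF that(1,2)] d_eq[OF that(1,2)] that(3) by (auto simp: apath_def)
  qed
  obtain ys where ys: "set ys = verts G"
    using finite_list[OF finite_verts] by blast
  define xs where "xs = sort_key (d s) ys"
  have xs: "set xs = verts G" "sorted (map (d s) xs)"
    by (simp_all add: xs_def ys)
  then have "xs \<noteq> []"
    using st(1) by auto
  from exists_awalk_through_sorted_list[OF step this equalityD1[OF xs(1)] subset_refl xs(2)]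
  obtain p where p: "awalk (hd xs) p (last xs)"
    "awalk_cost w p = d s (last xs) - d s (hd xs)" "verts G \<subseteq> set (awalk_verts (hd xs) p)"
    unfolding xs(1) by blast
  have ends: "hd xs \<in> verts G" "last xs \<in> verts G"
    using p(1) by (rule awalk_hd_in_verts, rule awalk_last_in_verts)
  \<comment> \<open>This fixes the sign of the telescoped difference, so it equals the absolute
    value that \<open>d_eq\<close> gives for the distance of the ends.\<close>
  have "0 \<le> awalk_cost w p"
    using p(1) nonneg by (rule pos_cost_pos_awalk_cost)
  then have "ereal (awalk_cost w p) = \<mu> w (hd xs) (last xs)"
    using p(2) \<mu>_d[OF ends] d_eq[OF ends] by simp
  with pos p(1) have "shortest_path w (hd xs) p (last xs)"
    by (rule minimal_awalk_imp_shortest_path)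
  with ends p(3) show ?thesis by blast
qed

end
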